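(* There is no pointed ordered $\lambda$-model with more than one element that satisfies both equations $\Theta x x = \Omega$ and $\Theta x\Omega = x$.
   Context: $\Omega \equiv (\lambda x.xx)(\lambda x.xx)$, $B \equiv \lambda x.x(\lambda y.yx)$, $C \equiv \lambda z.zB$, $\Theta \equiv BC$. A combinatory algebra is a structure $(A,\cdot,K,S)$ with a binary operation (application, associating to the left) satisfying $Kxy=x$ and $Sxyz=xz(yz)$. Let $I\equiv SKK$, $\varepsilon_1\equiv\varepsilon \equiv S(KI)$, $\varepsilon_{n+1}\equiv S(K\varepsilon)(S(K\varepsilon_n))$. A $\lambda$-model is a combinatory algebra satisfying moreover $\forall x y((\forall z.\ xz=yz)\Rightarrow \varepsilon x=\varepsilon y)$, $\varepsilon_2K=K$ and $\varepsilon_3 S=S$; $\lambda$-terms are interpreted in it in the standard way relative to environments ($|x|_\rho=\rho(x)$, $|MN|_\rho=|M|_\rho|N|_\rho$, $|\lambda x.M|_\rho=\varepsilon a$ for any $a$ representing $b\mapsto |M|_{\rho[x:=b]}$), and the model satisfies an equation $M=N$ if $|M|_\rho=|N|_\rho$ for all environments $\rho$. An ordered $\lambda$-model is a $\lambda$-model together with a partial order on its carrier making application monotone in both arguments; it is pointed if the partial order has a least element. *)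

theory Defs
  imports Main
begin

text \<open>Terms are raw syntax with named variables, not quotiented by \<open>\<alpha>\<close>-conversion.\<close>

datatype trm = Var nat | App trm trm | Lam nat trm

abbreviation "vx \<equiv> (0::nat)"
abbreviation "vy \<equiv> (1::nat)"
abbreviation "vz \<equiv> (2::nat)"

definition Omega_trm :: trm where
  "Omega_trm = App (Lam vx (App (Var vx) (Var vx))) (Lam vx (App (Var vx) (Var vx)))"

definition B_trm :: trm where
  "B_trm = Lam vx (App (Var vx) (Lam vy (App (Var vy) (Var vx))))"

definition C_trm :: trm where
  "C_trm = Lam vz (App (Var vz) B_trm)"

definition Theta_trm :: trm where
  "Theta_trm = App B_trm C_trm"

text \<open>The carrier of an algebra is the whole type \<open>'a\<close>.\<close>

locale combinatory_algebra =
  fixes app :: "'a \<Rightarrow> 'a \<Rightarrow> 'a"  (infixl "\<cdot>" 75)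
    and K S :: 'a
  assumes K_eq: "K \<cdot> x \<cdot> y = x"
    and S_eq: "S \<cdot> x \<cdot> y \<cdot> z = x \<cdot> z \<cdot> (y \<cdot> z)"
begin

definition I :: 'a where
  "I = S \<cdot> K \<cdot> K"

definition eps :: 'a where
  "eps = S \<cdot> (K \<cdot> I)"

text \<open>\<open>eps_n n\<close> is meaningful for \<open>n \<ge> 1\<close> only.\<close>

fun eps_n :: "nat \<Rightarrow> 'a" where
  "eps_n (Suc 0) = eps"
| "eps_n (Suc (Suc n)) = S \<cdot> (K \<cdot> eps) \<cdot> (S \<cdot> (K \<cdot> eps_n (Suc n)))"

end

locale lambda_model = combinatory_algebra +
  assumes weak_ext: "(\<forall>z. x \<cdot> z = y \<cdot> z) \<Longrightarrow> eps \<cdot> x = eps \<cdot> y"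
    and eps2_K: "eps_n 2 \<cdot> K = K"
    and eps3_S: "eps_n 3 \<cdot> S = S"
begin

text \<open>
  In the clause for abstraction a representing element always exists, and the value does not
  depend on which one is chosen: see \<open>representable\<close> and \<open>interp_Lam\<close> below.
\<close>

primrec interp :: "(nat \<Rightarrow> 'a) \<Rightarrow> trm \<Rightarrow> 'a" where
  "interp \<rho> (Var x) = \<rho> x"
| "interp \<rho> (App M N) = interp \<rho> M \<cdot> interp \<rho> N"
| "interp \<rho> (Lam x M) = eps \<cdot> (SOME a. \<forall>b. a \<cdot> b = interp (\<rho>(x := b)) M)"

definition satisfies :: "trm \<Rightarrow> trm \<Rightarrow> bool" where
  "satisfies M N \<longleftrightarrow> (\<forall>\<rho>. interp \<rho> M = interp \<rho> N)"

end

locale ordered_lambda_model = lambda_model +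
  fixes le :: "'a \<Rightarrow> 'a \<Rightarrow> bool"  (infix "\<sqsubseteq>" 50)
  assumes le_refl: "x \<sqsubseteq> x"
    and le_trans: "x \<sqsubseteq> y \<Longrightarrow> y \<sqsubseteq> z \<Longrightarrow> x \<sqsubseteq> z"
    and le_antisym: "x \<sqsubseteq> y \<Longrightarrow> y \<sqsubseteq> x \<Longrightarrow> x = y"
    and app_mono_left: "x \<sqsubseteq> x' \<Longrightarrow> x \<cdot> y \<sqsubseteq> x' \<cdot> y"
    and app_mono_right: "y \<sqsubseteq> y' \<Longrightarrow> x \<cdot> y \<sqsubseteq> x \<cdot> y'"

locale pointed_ordered_lambda_model = ordered_lambda_model +
  assumes pointed: "\<exists>b. \<forall>x. b \<sqsubseteq> x"

text \<open>
  \<open>poly t\<close> says that \<open>t\<close> is (the function on environments given by) a polynomial over the algebra;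
  closure under \<open>\<lambda>\<close> is combinatory completeness.
\<close>

inductive (in combinatory_algebra) poly :: "((nat \<Rightarrow> 'a) \<Rightarrow> 'a) \<Rightarrow> bool" where
  "poly (\<lambda>\<rho>. \<rho> x)"
| "poly (\<lambda>\<rho>. c)"
| "poly f \<Longrightarrow> poly g \<Longrightarrow> poly (\<lambda>\<rho>. f \<rho> \<cdot> g \<rho>)"

lemma (in combinatory_algebra) poly_abs:
  "poly f \<Longrightarrow> \<exists>g. poly g \<and> (\<forall>\<rho> b. g \<rho> \<cdot> b = f (\<rho>(x := b)))"
proof (induction rule: poly.induct)
  case (1 y)
  show ?case
  proof (cases "y = x")
    case True
    then show ?thesis
      by (intro exI[of _ "\<lambda>\<rho>. I"]) (auto simp: I_def K_eq S_eq intro: poly.intros)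
  next
    case False
    then show ?thesis
      by (intro exI[of _ "\<lambda>\<rho>. K \<cdot> \<rho> y"]) (auto simp: K_eq intro!: poly.intros)
  qed
next
  case (2 c)
  show ?case
    by (intro exI[of _ "\<lambda>\<rho>. K \<cdot> c"]) (auto simp: K_eq intro: poly.intros)
next
  case (3 f g)
  then obtain f' g' where "poly f'" "poly g'"
    "\<forall>\<rho> b. f' \<rho> \<cdot> b = f (\<rho>(x := b))" "\<forall>\<rho> b. g' \<rho> \<cdot> b = g (\<rho>(x := b))"
    by blast
  then show ?case
    by (intro exI[of _ "\<lambda>\<rho>. S \<cdot> f' \<rho> \<cdot> g' \<rho>"]) (auto simp: S_eq fun_upd_def intro!: poly.intros)
qed

context lambda_model
begin

lemma interp_Lam:
  assumes "\<forall>b. a \<cdot> b = interp (\<rho>(x := b)) M"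
  shows "interp \<rho> (Lam x M) = eps \<cdot> a"
proof -
  have "\<forall>b. (SOME a. \<forall>b. a \<cdot> b = interp (\<rho>(x := b)) M) \<cdot> b = interp (\<rho>(x := b)) M"
    by (rule someI[of "\<lambda>a. \<forall>b. a \<cdot> b = interp (\<rho>(x := b)) M", OF assms])
  with assms show ?thesis
    by (simp, intro weak_ext) simp
qed

lemma poly_interp: "poly (\<lambda>\<rho>. interp \<rho> M)"
proof (induction M)
  case (Lam x M)
  then obtain g where g: "poly g" "\<forall>\<rho> b. g \<rho> \<cdot> b = interp (\<rho>(x := b)) M"
    using poly_abs by blast
  then have "(\<lambda>\<rho>. interp \<rho> (Lam x M)) = (\<lambda>\<rho>. eps \<cdot> g \<rho>)"
    by (intro ext interp_Lam) simp
  with g show ?case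
    by (simp only:) (intro poly.intros)
qed (auto intro: poly.intros)

lemma representable: "\<exists>a. \<forall>b. a \<cdot> b = interp (\<rho>(x := b)) M"
  using poly_abs[OF poly_interp[of M], of x] by blast

end

end

theory Submission
  imports Defs
begin

text \<open>
  Write \<open>f x y\<close> for the interpretation of \<open>\<Theta> x y\<close> and \<open>o\<close> for that of \<open>\<Omega>\<close>; then \<open>f\<close> is monotone,
  \<open>f x x = o\<close> and \<open>f x o = x\<close>. If \<open>\<bottom>\<close> is least, then \<open>o = f \<bottom> \<bottom> \<sqsubseteq> f x o = x\<close> for every \<open>x\<close>,
  so \<open>o\<close> is least as well, and hence \<open>x = f x o \<sqsubseteq> f x x = o\<close>. Therefore every \<open>x\<close> equals \<open>o\<close>.
\<close>

text \<open>The term is closed: unfolding \<open>interp\<close> looks up only variables updated by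
  an enclosing \<open>Lam\<close>, so the environment disappears.\<close>

lemma (in lambda_model) interp_Omega_cong: "interp \<rho> Omega_trm = interp \<sigma> Omega_trm"
  by (simp add: Omega_trm_def)

lemma (in lambda_model) interp_Theta_cong: "interp \<rho> Theta_trm = interp \<sigma> Theta_trm"
  by (simp add: Theta_trm_def B_trm_def C_trm_def)

lemma (in pointed_ordered_lambda_model) subtractive_imp_trivial:
  assumes diag: "\<And>x. t \<cdot> x \<cdot> x = c" and right: "\<And>x. t \<cdot> x \<cdot> c = x"
  shows "x = c"
proof -
  obtain b where b: "\<And>x. b \<sqsubseteq> x"
    using pointed by blast
  \<comment> \<open>Raise one argument at a time, through
    \<open>t \<cdot> x \<cdot> b\<close>.\<close>
  have "t \<cdot> b \<cdot> b \<sqsubseteq> t \<cdot> x \<cdot> c"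
    by (blast intro: le_trans app_mono_left app_mono_right b)
  then have "c \<sqsubseteq> x"
    by (simp add: diag right)
  moreover from this have "t \<cdot> x \<cdot> c \<sqsubseteq> t \<cdot> x \<cdot> x"
    by (rule app_mono_right)
  then have "x \<sqsubseteq> c"
    by (simp add: diag right)
  ultimately show ?thesis
    by (intro le_antisym)
qed

theorem theorem3p2:
  "\<not> (\<exists>(app :: 'a \<Rightarrow> 'a \<Rightarrow> 'a) K S le.
        pointed_ordered_lambda_model app K S le \<and>
        (\<exists>a b :: 'a. a \<noteq> b) \<and>
        lambda_model.satisfies app K S
          (App (App Theta_trm (Var vx)) (Var vx)) Omega_trm \<and>
        lambda_model.satisfies app K S
          (App (App Theta_trm (Var vx)) Omega_trm) (Var vx))"
proof (intro notI, elim exE conjE)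
  fix app :: "'a \<Rightarrow> 'a \<Rightarrow> 'a" and K S le and a b :: 'a
  assume model: "pointed_ordered_lambda_model app K S le" and "a \<noteq> b"
    and diag: "lambda_model.satisfies app K S
      (App (App Theta_trm (Var vx)) (Var vx)) Omega_trm"
    and right: "lambda_model.satisfies app K S
      (App (App Theta_trm (Var vx)) Omega_trm) (Var vx)"
  interpret pointed_ordered_lambda_model app K S le
    by (fact model)
  \<comment> \<open>The environment is arbitrary here; \<open>a\<close> merely supplies a
    value.\<close>
  define t where "t = interp (\<lambda>_. a) Theta_trm"
  define c where "c = interp (\<lambda>_. a) Omega_trm"
  have t: "interp \<rho> Theta_trm = t" and c: "interp \<rho> Omega_trm = c" for \<rho>
    unfolding t_def c_def by (rule interp_Theta_cong interp_Omega_cong)+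
  have "app (app t x) x = c" and "app (app t x) c = x" for x
    \<comment> \<open>The constant environment makes \<open>Var vx\<close> denote
      \<open>x\<close>.\<close>
    using diag[unfolded satisfies_def, rule_format, of "\<lambda>_. x"]
      right[unfolded satisfies_def, rule_format, of "\<lambda>_. x"]
    by (simp_all add: t c)
  then have "x = c" for x
    by (rule subtractive_imp_trivial)
  with \<open>a \<noteq> b\<close> show False
    by metis
qed

end
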